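(* Let $V_h^1\subset V^1$ and $W_h^2\subset W^2$ be finite-dimensional subspaces with $\mathrm{d}V_h^1\subset W_h^2$, and suppose that the discrete Poincaré inequality $$\|v_h\|_\alpha\le C_{\mathrm{P},h}\|\mathrm{d}v_h\|_{\gamma^{-1}}\qquad\forall v_h\in Z_h^{\perp_\beta}$$ holds with a constant $C_{\mathrm{P},h}>0$. Let $(u_h,u_h^* )\in C^1([0,\infty);V_h^1\times W_h^2)$ be any solution of $$\langle\alpha\partial_tu_h(t),v_h\rangle_{W^1}-\langle u_h^*(t),\mathrm{d}v_h\rangle_{W^2}=-\langle\beta u_h(t),v_h\rangle_{W^1},$$ $$\langle\gamma\partial_tu_h^*(t),v_h^*\rangle_{W^2}+\langle\mathrm{d}u_h(t),v_h^*\rangle_{W^2}=0$$ for all $v_h\in V_h^1$, $v_h^*\in W_h^2$ and $t\ge0$, which satisfies the compatibility condition $$\langle\gamma u_h^*(0),y_h^*\rangle_{W^2}=0\qquad\text{for all } y_h^*\in Y_h^2.$$ Then $$\|u_h(t)\|_\alpha^2+\|u_h^*(t)\|_\gamma^2\le C''e^{-c''(t-s)}\big(\|u_h(s)\|_\alpha^2+\|u_h^*(s)\|_\gamma^2\big)\qquad\forall\,0\le s\le t,$$ with constants $C'',c''>0$ depending on the discrete Poincaré constant $C_{\mathrm{P},h}$, but otherwise independent of the spaces $V_h^1,W_h^2$ and of the particular solution $(u_h,u_h^* )$.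
   Context: $W^1,W^2$ are real Hilbert spaces with scalar products $\langle\cdot,\cdot\rangle_{W^1}$, $\langle\cdot,\cdot\rangle_{W^2}$. $\mathrm{d}:V^1\subset W^1\to W^2$ is a densely defined closed linear operator with domain $V^1$. $\alpha,\beta:W^1\to W^1$ and $\gamma:W^2\to W^2$ are selfadjoint positive isomorphisms; these data are fixed. Write $\|u\|_\alpha^2=\langle\alpha u,u\rangle_{W^1}$, $\|u^*\|_\gamma^2=\langle\gamma u^*,u^*\rangle_{W^2}$, $\|u^*\|_{\gamma^{-1}}^2=\langle\gamma^{-1}u^*,u^*\rangle_{W^2}$; these norms are equivalent to the natural ones. For finite-dimensional $V_h^1\subset V^1$, $W_h^2\subset W^2$ set $Z_h=\{z_h\in V_h^1:\mathrm{d}z_h=0\}$, $Z_h^{\perp_\beta}=\{v_h\in V_h^1:\langle\beta v_h,z_h\rangle_{W^1}=0\ \forall z_h\in Z_h\}$, and $Y_h^2=\{v_h^*\in W_h^2:\langle\gamma v_h^*,\mathrm{d}v_h\rangle_{W^2}=0\ \forall v_h\in V_h^1\}$, the orthogonal complement in the splitting $W_h^2=\mathrm{d}V_h^1\oplus Y_h^2$.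
   Formalization: Y_h^2 is taken as {v* in W_h^2 : <v*, d v_h> = 0 for all v_h in V_h^1}, without the weight γ; with γ in its definition the decay fails, e.g. W^1=R, W^2=R^2, α=1, β=5/3, dx=(x,0), γ=[[2,1],[1,2]], u_h(0)=1, u_h^*(0)=(1,0). *)

theory Defs
  imports "HOL-Analysis.Analysis"
begin

(* Real Hilbert spaces are types of sort {real_inner, complete_space}. *)

(* An unbounded operator is a pair of its domain V1 and a total function d whose values
   outside V1 are irrelevant. *)
definition densely_defined_closed_operator ::
    "'a::{real_inner,complete_space} set \<Rightarrow> ('a \<Rightarrow> 'b::{real_inner,complete_space}) \<Rightarrow> bool" where
  "densely_defined_closed_operator V1 d \<longleftrightarrow>
     subspace V1 \<and> closure V1 = UNIV \<and>
     (\<forall>x\<in>V1. \<forall>y\<in>V1. d (x + y) = d x + d y) \<and>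
     (\<forall>c. \<forall>x\<in>V1. d (c *\<^sub>R x) = c *\<^sub>R d x) \<and>
     closed ((\<lambda>x. (x, d x)) ` V1)"

(* Positivity is the weak inequality of operator theory; for a selfadjoint isomorphism it
   already implies a bound inner (A x) x \<ge> c * (norm x)^2 with c > 0. *)
definition selfadjoint_positive_iso :: "('a::{real_inner,complete_space} \<Rightarrow> 'a) \<Rightarrow> bool" where
  "selfadjoint_positive_iso A \<longleftrightarrow>
     bounded_linear A \<and> bij A \<and> bounded_linear (inv A) \<and>
     (\<forall>x y. inner (A x) y = inner x (A y)) \<and>
     (\<forall>x. 0 \<le> inner (A x) x)"

definition weighted_norm :: "('a::real_inner \<Rightarrow> 'a) \<Rightarrow> 'a \<Rightarrow> real" where
  "weighted_norm A x = sqrt (inner (A x) x)"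

definition fin_dim_subspace :: "'a::real_vector set \<Rightarrow> bool" where
  "fin_dim_subspace V \<longleftrightarrow> subspace V \<and> (\<exists>B. finite B \<and> span B = V)"

definition discrete_kernel :: "('a::real_inner \<Rightarrow> 'b::real_inner) \<Rightarrow> 'a set \<Rightarrow> 'a set" where
  "discrete_kernel d Vh = {z \<in> Vh. d z = 0}"

definition discrete_kernel_perp ::
    "('a::real_inner \<Rightarrow> 'a) \<Rightarrow> ('a \<Rightarrow> 'b::real_inner) \<Rightarrow> 'a set \<Rightarrow> 'a set" where
  "discrete_kernel_perp \<beta> d Vh =
     {v \<in> Vh. \<forall>z\<in>discrete_kernel d Vh. inner (\<beta> v) z = 0}"

definition discrete_poincare ::
    "('a::real_inner \<Rightarrow> 'a) \<Rightarrow> ('a \<Rightarrow> 'a) \<Rightarrow> ('b::real_inner \<Rightarrow> 'b) \<Rightarrow> ('a \<Rightarrow> 'b)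
      \<Rightarrow> 'a set \<Rightarrow> real \<Rightarrow> bool" where
  "discrete_poincare \<alpha> \<beta> \<gamma> d Vh CP \<longleftrightarrow>
     (\<forall>v\<in>discrete_kernel_perp \<beta> d Vh. weighted_norm \<alpha> v \<le> CP * weighted_norm (inv \<gamma>) (d v))"

(* The orthogonal complement Y_h of d V_h in W_h is taken in the scalar product of W^2, without
   the weight \<gamma>.  The weight enters in the compatibility condition
   inner (\<gamma> (u*(0))) y = 0 for y in Y_h.  For y in Y_h the pairing inner (\<gamma> (u*(t))) y
   is conserved by the evolution, since its derivative is - inner (d (u(t))) y = 0; so its
   vanishing is necessary for exponential decay.
   If Y_h is replaced by {y in W_h. inner (\<gamma> y) (d v) = 0 for all v in V_h}, this necessary
   condition is no longer imposed and the decay estimate fails: take W^1 = V_h = R,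
   W^2 = W_h = R^2, \<alpha> = 1, \<beta> = 5/3, d x = (x, 0), \<gamma> (x, y) = (2x + y, x + 2y).
   With E = exp (-2t/3), u(t) = E, u*(t) = (E, (1 - E)/2) is a solution, u*(0) = (1, 0) lies
   in d V_h, and u*(t) tends to (0, 1/2).
   Both choices agree if \<gamma> is a multiple of the identity or if d V_h = W_h. *)
definition discrete_range_complement ::
    "('a::real_inner \<Rightarrow> 'b::real_inner) \<Rightarrow> 'a set \<Rightarrow> 'b set \<Rightarrow> 'b set" where
  "discrete_range_complement d Vh Wh = {y \<in> Wh. \<forall>v\<in>Vh. inner y (d v) = 0}"

(* One-sided derivative at t = 0; values of u at negative times are irrelevant. *)
abbreviation time_deriv :: "(real \<Rightarrow> 'a::real_normed_vector) \<Rightarrow> real \<Rightarrow> 'a" where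
  "time_deriv u t \<equiv> vector_derivative u (at t within {0..})"

definition C1_halfline :: "'a::real_normed_vector set \<Rightarrow> (real \<Rightarrow> 'a) \<Rightarrow> bool" where
  "C1_halfline V u \<longleftrightarrow>
     (\<forall>t\<ge>0. u t \<in> V) \<and>
     (\<forall>t\<ge>0. u differentiable (at t within {0..})) \<and>
     continuous_on {0..} (time_deriv u)"

definition discrete_solution ::
    "('a::real_inner \<Rightarrow> 'a) \<Rightarrow> ('a \<Rightarrow> 'a) \<Rightarrow> ('b::real_inner \<Rightarrow> 'b) \<Rightarrow> ('a \<Rightarrow> 'b)
      \<Rightarrow> 'a set \<Rightarrow> 'b set \<Rightarrow> (real \<Rightarrow> 'a) \<Rightarrow> (real \<Rightarrow> 'b) \<Rightarrow> bool" where
  "discrete_solution \<alpha> \<beta> \<gamma> d Vh Wh u us \<longleftrightarrow>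
     C1_halfline Vh u \<and> C1_halfline Wh us \<and>
     (\<forall>t\<ge>0. \<forall>v\<in>Vh.
        inner (\<alpha> (time_deriv u t)) v - inner (us t) (d v) = - inner (\<beta> (u t)) v) \<and>
     (\<forall>t\<ge>0. \<forall>w\<in>Wh.
        inner (\<gamma> (time_deriv us t)) w + inner (d (u t)) w = 0)"

end

theory Submission
  imports Defs
begin

text \<open>
  Testing the two equations with \<open>u\<close> and \<open>u\<^sup>*\<close> shows that the energy
  \<open>E = \<parallel>u\<parallel>\<^sub>\<alpha>\<^sup>2 + \<parallel>u\<^sup>*\<parallel>\<^sub>\<gamma>\<^sup>2\<close> satisfies \<open>E' = - 2 \<langle>\<beta> u, u\<rangle>\<close>: the coupling terms cancel, and only
  \<open>u\<close> is damped directly (\<open>energy_has_derivative\<close>). The damping has to be transferred to \<open>u\<^sup>*\<close>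
  through the coupling operator, and the vehicle for that is a potential of \<open>u\<^sup>*\<close>.

  The part of \<open>\<gamma> u\<^sup>*(t)\<close> along the complement of \<open>d V\<^sub>h\<close> in \<open>W\<^sub>h\<close> is conserved, so it vanishes for all
  times by compatibility. Hence, as a functional on \<open>W\<^sub>h\<close>, \<open>\<gamma> u\<^sup>*(t)\<close> equals \<open>d \<phi>(t)\<close> with
  a unique \<open>\<phi>(t)\<close> in the \<open>\<beta>\<close>-complement of the kernel of \<open>d\<close> (\<open>potential_exists\<close>), and the
  Poincare inequality bounds \<open>\<phi>\<close> by \<open>u\<^sup>*\<close> (\<open>potential_norm_le\<close>). The second equation says that
  \<open>- d u\<close> is the derivative of \<open>d \<phi>\<close>, so that \<open>- \<phi>'\<close> is the \<open>\<beta>\<close>-orthogonal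
  projection of \<open>u\<close>, and this is bounded by \<open>u\<close>. Testing the first equation with \<open>\<phi>\<close> gives
  \<open>\<langle>\<alpha> u, \<phi>\<rangle>' = \<parallel>u\<^sup>*\<parallel>\<^sub>\<gamma>\<^sup>2 - \<langle>\<beta> u, \<phi>\<rangle> + \<langle>\<alpha> u, \<phi>'\<rangle>\<close>, whose last two terms are of size \<open>\<parallel>u\<parallel> \<parallel>u\<^sup>*\<parallel>\<close> and \<open>\<parallel>u\<parallel>\<^sup>2\<close> (\<open>cross_term_has_derivative\<close>).

  For small \<open>\<epsilon>\<close> the functional \<open>F = E - \<epsilon> \<langle>\<alpha> u, \<phi>\<rangle>\<close> therefore lies between \<open>E / 2\<close> and
  \<open>3 E / 2\<close> and satisfies \<open>F' \<le> - c F\<close>, which yields the decay of \<open>E\<close> with the factor 3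
  (\<open>energy_decay\<close>). The numbers \<open>\<epsilon>\<close> and \<open>c\<close> are explicit in the bounds of the weights and in
  the Poincare constant, which is why they do not depend on the discrete spaces.
\<close>

section \<open>Weights and finite-dimensional projections\<close>

text \<open>
  The quantitative content of being a selfadjoint positive isomorphism. Carrying the bounds as
  parameters makes visible which constants the decay rate depends on.
\<close>
definition elliptic :: "real \<Rightarrow> real \<Rightarrow> ('a::real_inner \<Rightarrow> 'a) \<Rightarrow> bool" where
  "elliptic m M A \<longleftrightarrow> linear A \<and> (\<forall>x y. inner (A x) y = inner x (A y)) \<and>
     (\<forall>x. m * (norm x)\<^sup>2 \<le> inner (A x) x) \<and> (\<forall>x. norm (A x) \<le> M * norm x)"

lemma elliptic_linear: "elliptic m M A \<Longrightarrow> linear A"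
  and elliptic_sym: "elliptic m M A \<Longrightarrow> inner (A x) y = inner x (A y)"
  and elliptic_lower: "elliptic m M A \<Longrightarrow> m * (norm x)\<^sup>2 \<le> inner (A x) x"
  and elliptic_norm: "elliptic m M A \<Longrightarrow> norm (A x) \<le> M * norm x"
  by (auto simp: elliptic_def)

lemma elliptic_inner_le:
  assumes "elliptic m M A"
  shows "\<bar>inner (A x) y\<bar> \<le> M * norm x * norm y"
proof -
  have "\<bar>inner (A x) y\<bar> \<le> norm (A x) * norm y"
    by (rule Cauchy_Schwarz_ineq2)
  also have "\<dots> \<le> M * norm x * norm y"
    by (intro mult_right_mono elliptic_norm[OF assms]) simp
  finally show ?thesis .
qed

lemma elliptic_upper:
  assumes "elliptic m M A"
  shows "inner (A x) x \<le> M * (norm x)\<^sup>2"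
  using elliptic_inner_le[OF assms, of x x] by (simp add: power2_eq_square mult.assoc)

lemma elliptic_mono:
  assumes "elliptic m M A" "m' \<le> m" "M \<le> M'"
  shows "elliptic m' M' A"
  unfolding elliptic_def
proof (intro conjI allI)
  fix x
  show "m' * (norm x)\<^sup>2 \<le> inner (A x) x"
    using mult_right_mono[OF assms(2), of "(norm x)\<^sup>2"] elliptic_lower[OF assms(1), of x] by simp
  show "norm (A x) \<le> M' * norm x"
    using mult_right_mono[OF assms(3), of "norm x"] elliptic_norm[OF assms(1), of x] by simp
qed (use elliptic_linear[OF assms(1)] elliptic_sym[OF assms(1)] in auto)

text \<open>
  The discriminant argument for a form that need not be definite: the quadratic polynomial
  \<open>t \<mapsto> \<langle>A (x + t y), x + t y\<rangle>\<close> is nonnegative, and becomes affine when \<open>\<langle>A y, y\<rangle> = 0\<close>.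
\<close>
lemma positive_form_Cauchy_Schwarz:
  assumes "linear A" and sym: "\<And>x y. inner (A x) y = inner x (A y)"
    and pos: "\<And>x. 0 \<le> inner (A x) x"
  shows "(inner (A x) y)\<^sup>2 \<le> inner (A x) x * inner (A y) y"
proof -
  interpret linear A by fact
  define a where "a = inner (A x) x"
  define b where "b = inner (A x) y"
  define c where "c = inner (A y) y"
  have q: "0 \<le> a + 2 * t * b + t\<^sup>2 * c" for t
  proof -
    have "inner (A (x + t *\<^sub>R y)) (x + t *\<^sub>R y) = a + 2 * t * b + t\<^sup>2 * c"
      using sym[of y x] unfolding a_def b_def c_def
      by (simp add: add scale inner_add_left inner_add_right algebra_simps power2_eq_square
          inner_commute)
    then show ?thesis using pos[of "x + t *\<^sub>R y"] by simp
  qed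
  have a0: "0 \<le> a" and c0: "0 \<le> c" using pos by (auto simp: a_def c_def)
  have "b\<^sup>2 \<le> a * c"
  proof (cases "c = 0")
    case True
    have "b = 0"
    proof (rule ccontr)
      assume "b \<noteq> 0"
      then show False using q[of "-(a + 1) / (2 * b)"] True by (simp add: field_simps)
    qed
    then show ?thesis using a0 c0 by simp
  next
    case False
    then have cp: "c > 0" using c0 by simp
    have "0 \<le> a - b\<^sup>2 / c"
      using q[of "- b / c"] cp by (simp add: field_simps power2_eq_square)
    then show ?thesis using cp by (simp add: field_simps)
  qed
  then show ?thesis by (simp add: a_def b_def c_def)
qed

text \<open>
  Positivity improves to coercivity because of invertibility: Cauchy-Schwarz for the form of \<open>A\<close>
  with second argument \<open>A x\<close> gives \<open>\<parallel>A x\<parallel>\<^sup>2 \<le> \<parallel>A\<parallel> \<langle>A x, x\<rangle>\<close>, and \<open>\<parallel>x\<parallel> \<le> \<parallel>A\<^sup>-\<^sup>1\<parallel> \<parallel>A x\<parallel>\<close>.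
\<close>
lemma selfadjoint_positive_iso_elliptic:
  assumes "selfadjoint_positive_iso A"
  obtains m M where "m > 0" "M > 0" "elliptic m M A"
proof -
  have bl: "bounded_linear A" and bij: "bij A" and bli: "bounded_linear (inv A)"
    and sym: "\<And>x y. inner (A x) y = inner x (A y)" and pos: "\<And>x. 0 \<le> inner (A x) x"
    using assms by (auto simp: selfadjoint_positive_iso_def)
  have lin: "linear A" using bl by (rule bounded_linear.linear)
  obtain M where M: "M > 0" "\<And>x. norm (A x) \<le> norm x * M"
    using bounded_linear.pos_bounded[OF bl] by blast
  obtain N where N: "N > 0" "\<And>x. norm (inv A x) \<le> norm x * N"
    using bounded_linear.pos_bounded[OF bli] by blast
  define m where "m = 1 / (N\<^sup>2 * M)"
  have low: "m * (norm x)\<^sup>2 \<le> inner (A x) x" for x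
  proof -
    have AA: "inner (A (A x)) (A x) \<le> M * (norm (A x))\<^sup>2"
    proof -
      have "inner (A (A x)) (A x) \<le> norm (A (A x)) * norm (A x)"
        by (rule norm_cauchy_schwarz)
      also have "\<dots> \<le> (norm (A x) * M) * norm (A x)"
        by (intro mult_right_mono M) simp
      finally show ?thesis by (simp add: power2_eq_square mult.commute mult.left_commute)
    qed
    have "(norm (A x))\<^sup>2 * (norm (A x))\<^sup>2 = (inner (A x) (A x))\<^sup>2"
      by (simp only: power2_norm_eq_inner) (simp add: power2_eq_square)
    also have "\<dots> \<le> inner (A x) x * inner (A (A x)) (A x)"
      by (rule positive_form_Cauchy_Schwarz[OF lin sym pos])
    also have "\<dots> \<le> inner (A x) x * (M * (norm (A x))\<^sup>2)"
      by (intro mult_left_mono AA pos)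
    finally have 1: "(norm (A x))\<^sup>2 \<le> M * inner (A x) x"
    proof (cases "A x = 0")
      case False
      assume "(norm (A x))\<^sup>2 * (norm (A x))\<^sup>2 \<le> inner (A x) x * (M * (norm (A x))\<^sup>2)"
      then have "(norm (A x))\<^sup>2 * (norm (A x))\<^sup>2 \<le> (M * inner (A x) x) * (norm (A x))\<^sup>2"
        by (simp add: mult.commute mult.left_commute)
      then show ?thesis by (rule mult_right_le_imp_le) (use False in simp)
    qed simp
    have "norm x \<le> norm (A x) * N"
      using N(2)[of "A x"] bij by (simp add: bij_is_inj)
    then have "(norm x)\<^sup>2 \<le> (norm (A x) * N)\<^sup>2"
      by (rule power_mono) simp
    also have "\<dots> = N\<^sup>2 * (norm (A x))\<^sup>2" by (simp add: power_mult_distrib)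
    also have "\<dots> \<le> N\<^sup>2 * (M * inner (A x) x)"
      using 1 by (rule mult_left_mono) simp
    finally show ?thesis using M N by (simp add: m_def field_simps)
  qed
  have "elliptic m M A"
    using lin sym low M(2) by (auto simp: elliptic_def mult.commute)
  then show ?thesis using that[of m M] M N by (simp add: m_def)
qed

lemma weighted_norm_square:
  assumes "elliptic m M A" "m > 0"
  shows "(weighted_norm A x)\<^sup>2 = inner (A x) x"
proof -
  have "0 \<le> m * (norm x)\<^sup>2" using assms by simp
  also have "\<dots> \<le> inner (A x) x" by (rule elliptic_lower[OF assms(1)])
  finally show ?thesis by (simp add: weighted_norm_def)
qed

text \<open>
  One Gram-Schmidt step per generator: the projection onto the larger span adds the component along
  the residual \<open>r\<close> of the new generator. If \<open>r = 0\<close>, the generator contributes nothing, and division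
  by zero makes the coefficient harmless.
\<close>
lemma elliptic_projection_span:
  assumes A: "elliptic m M A" "m > 0" and "finite B"
  shows "\<exists>p\<in>span B. \<forall>z\<in>span B. inner (A (x - p)) z = 0"
  using \<open>finite B\<close>
proof (induction B arbitrary: x rule: finite_induct)
  case empty
  then show ?case by simp
next
  case (insert b F)
  interpret linear A by (rule elliptic_linear[OF A(1)])
  obtain p where p: "p \<in> span F" "\<And>z. z \<in> span F \<Longrightarrow> inner (A (x - p)) z = 0"
    using insert.IH by blast
  obtain q where q: "q \<in> span F" "\<And>z. z \<in> span F \<Longrightarrow> inner (A (b - q)) z = 0"
    using insert.IH by blast
  define r where "r = b - q"
  define c where "c = inner (A (x - p)) r / inner (A r) r"
  have mono: "span F \<subseteq> span (insert b F)" by (rule span_mono) auto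
  have r_in: "r \<in> span (insert b F)"
    unfolding r_def using q mono by (intro span_diff span_base[of b]) auto
  have r_orth: "inner (A (x - (p + c *\<^sub>R r))) r = 0"
  proof (cases "r = 0")
    case False
    have "0 < m * (norm r)\<^sup>2" using False A(2) by simp
    also have "\<dots> \<le> inner (A r) r" by (rule elliptic_lower[OF A(1)])
    finally have "inner (A r) r \<noteq> 0" by simp
    then show ?thesis
      by (simp add: c_def diff add scale inner_diff_left inner_add_left)
  qed simp
  have F_orth: "inner (A (x - (p + c *\<^sub>R r))) z = 0" if "z \<in> span F" for z
    using p(2)[OF that] q(2)[OF that]
    by (simp add: r_def diff add scale inner_diff_left inner_add_left)
  have "inner (A (x - (p + c *\<^sub>R r))) z = 0" if "z \<in> span (insert b F)" for z
  proof -
    obtain k where k: "z - k *\<^sub>R b \<in> span F"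
      using \<open>z \<in> span (insert b F)\<close> unfolding span_insert by blast
    have "(z - k *\<^sub>R b) + k *\<^sub>R q \<in> span F"
      using k q by (intro span_add span_scale)
    moreover have "z = ((z - k *\<^sub>R b) + k *\<^sub>R q) + k *\<^sub>R r"
      by (simp add: r_def algebra_simps)
    ultimately show ?thesis using F_orth r_orth
      by (metis inner_add_right inner_scaleR_right mult_zero_right add_0)
  qed
  moreover have "p + c *\<^sub>R r \<in> span (insert b F)"
    using p mono r_in by (intro span_add span_scale) auto
  ultimately show ?case by blast
qed

lemma fin_dim_subspace_subset:
  assumes "fin_dim_subspace V" "subspace S" "S \<subseteq> V"
  shows "fin_dim_subspace S"
proof -
  obtain B where B: "finite B" "span B = V"
    using assms(1) by (auto simp: fin_dim_subspace_def)
  obtain C where C: "C \<subseteq> S" "independent C" "S \<subseteq> span C"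
    using maximal_independent_subset[of S] by metis
  have "finite C"
    using independent_span_bound[OF B(1) C(2)] C(1) assms(3) B(2) by blast
  moreover have "span C = S"
    using C assms(2) span_minimal by blast
  ultimately show ?thesis using assms(2) by (auto simp: fin_dim_subspace_def)
qed

lemma elliptic_projection:
  assumes "elliptic m M A" "m > 0" "fin_dim_subspace S"
  obtains p where "p \<in> S" "\<And>z. z \<in> S \<Longrightarrow> inner (A (x - p)) z = 0"
  using elliptic_projection_span[OF assms(1,2)] assms(3)
  unfolding fin_dim_subspace_def by metis

lemma elliptic_id: "elliptic 1 1 (\<lambda>x. x)"
  by (simp add: elliptic_def power2_norm_eq_inner linear_ident)

section \<open>The discrete system and its potentials\<close>

text \<open>
  All estimates are carried out in the unweighted norms, with common bounds \<open>m\<close> and \<open>M\<close> for the three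
  weights and the Poincare inequality rephrased accordingly with the constant \<open>K\<close>.
\<close>
locale discrete_system =
  fixes Vh :: "'a::real_inner set" and Wh :: "'b::real_inner set"
    and d :: "'a \<Rightarrow> 'b" and \<alpha> \<beta> :: "'a \<Rightarrow> 'a" and \<gamma> :: "'b \<Rightarrow> 'b" and m M K :: real
  assumes Vh: "fin_dim_subspace Vh" and Wh: "fin_dim_subspace Wh"
    and d_add: "\<And>x y. x \<in> Vh \<Longrightarrow> y \<in> Vh \<Longrightarrow> d (x + y) = d x + d y"
    and d_scale: "\<And>c x. x \<in> Vh \<Longrightarrow> d (c *\<^sub>R x) = c *\<^sub>R d x"
    and d_Wh: "\<And>x. x \<in> Vh \<Longrightarrow> d x \<in> Wh"
    and m: "m > 0" and M: "M > 0" and K: "K > 0"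
    and \<alpha>: "elliptic m M \<alpha>" and \<beta>: "elliptic m M \<beta>" and \<gamma>: "elliptic m M \<gamma>"
    and poincare: "\<And>v. v \<in> discrete_kernel_perp \<beta> d Vh \<Longrightarrow> norm v \<le> K * norm (d v)"
begin

lemma Vh_subspace: "subspace Vh" and Wh_subspace: "subspace Wh"
  using Vh Wh by (auto simp: fin_dim_subspace_def)

lemma d_diff: "x \<in> Vh \<Longrightarrow> y \<in> Vh \<Longrightarrow> d (x - y) = d x - d y"
  using d_add[of x "(-1) *\<^sub>R y"] d_scale[of y "-1"] subspace_scale[OF Vh_subspace, of y "-1"]
  by simp

lemma d_zero: "d 0 = 0"
  using d_scale[of 0 0] subspace_0[OF Vh_subspace] by simp

lemma perp_subspace: "subspace (discrete_kernel_perp \<beta> d Vh)"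
proof -
  interpret linear \<beta> by (rule elliptic_linear[OF \<beta>])
  show ?thesis
    using Vh_subspace
    by (auto simp: subspace_def discrete_kernel_perp_def zero add scale inner_add_left)
qed

lemma perp_Vh: "v \<in> discrete_kernel_perp \<beta> d Vh \<Longrightarrow> v \<in> Vh"
  by (simp add: discrete_kernel_perp_def)

lemma kernel_fin_dim: "fin_dim_subspace (discrete_kernel d Vh)"
proof (rule fin_dim_subspace_subset[OF Vh])
  show "subspace (discrete_kernel d Vh)"
    using Vh_subspace by (auto simp: subspace_def discrete_kernel_def d_zero d_add d_scale)
qed (auto simp: discrete_kernel_def)

lemma range_fin_dim: "fin_dim_subspace (d ` Vh)"
proof (rule fin_dim_subspace_subset[OF Wh])
  show "subspace (d ` Vh)"
    unfolding subspace_def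
  proof (intro conjI ballI allI)
    show "0 \<in> d ` Vh"
      using d_zero subspace_0[OF Vh_subspace] by (metis imageI)
    show "x + y \<in> d ` Vh" if "x \<in> d ` Vh" "y \<in> d ` Vh" for x y
      using that d_add subspace_add[OF Vh_subspace] by (smt (verit) imageE imageI)
    show "c *\<^sub>R x \<in> d ` Vh" if "x \<in> d ` Vh" for c x
      using that d_scale subspace_scale[OF Vh_subspace] by (smt (verit) imageE imageI)
  qed
qed (use d_Wh in auto)

text \<open>
  Subtracting the \<open>\<beta>\<close>-projection onto the kernel leaves \<open>d v\<close> unchanged, and an orthogonal
  projection does not increase the \<open>\<beta>\<close>-norm; comparing norms costs the factor \<open>M / m\<close>.
\<close>
lemma kernel_splitting:
  assumes "v \<in> Vh"
  obtains p where "p \<in> discrete_kernel_perp \<beta> d Vh" "d p = d v" "norm p \<le> M / m * norm v"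
proof -
  obtain z where z: "z \<in> discrete_kernel d Vh"
    "\<And>y. y \<in> discrete_kernel d Vh \<Longrightarrow> inner (\<beta> (v - z)) y = 0"
    using elliptic_projection[OF \<beta> m kernel_fin_dim] by metis
  have zV: "z \<in> Vh" "d z = 0" using z(1) by (auto simp: discrete_kernel_def)
  define p where "p = v - z"
  have pp: "p \<in> discrete_kernel_perp \<beta> d Vh"
    using z(2) assms zV subspace_diff[OF Vh_subspace]
    by (auto simp: discrete_kernel_perp_def p_def)
  have "m * (norm p)\<^sup>2 \<le> inner (\<beta> p) p" by (rule elliptic_lower[OF \<beta>])
  also have "\<dots> = inner (\<beta> p) v"
    using z by (simp add: p_def inner_diff_right)
  also have "\<dots> \<le> M * norm p * norm v"
    using elliptic_inner_le[OF \<beta>, of p v] by simp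
  finally have *: "(m * norm p) * norm p \<le> (M * norm v) * norm p"
    by (simp add: power2_eq_square algebra_simps)
  have "m * norm p \<le> M * norm v"
  proof (cases "p = 0")
    case True
    then show ?thesis using M by simp
  next
    case False
    then show ?thesis using mult_right_le_imp_le[OF *] by simp
  qed
  then have "norm p \<le> M / m * norm v" using m by (simp add: field_simps)
  moreover have "d p = d v" using d_diff assms zV by (simp add: p_def)
  ultimately show ?thesis using that pp by blast
qed

text \<open>
  A relation instead of a solution operator: it is linear in the pair \<open>(x, \<phi>)\<close>, and the norm bound
  below makes the potential unique, so no choice of \<open>\<phi>\<close> has to be shown to be linear.
\<close>
definition is_potential :: "'b \<Rightarrow> 'a \<Rightarrow> bool" where
  "is_potential x \<phi> \<longleftrightarrow> \<phi> \<in> discrete_kernel_perp \<beta> d Vh \<and>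
     (\<forall>w\<in>Wh. inner (\<gamma> x) w = inner (d \<phi>) w)"

lemma is_potential_diff:
  assumes "is_potential x \<phi>" "is_potential y \<psi>"
  shows "is_potential (x - y) (\<phi> - \<psi>)"
proof -
  interpret linear \<gamma> by (rule elliptic_linear[OF \<gamma>])
  show ?thesis
    using assms perp_Vh subspace_diff[OF perp_subspace]
    by (auto simp: is_potential_def diff d_diff inner_diff_left)
qed

lemma is_potential_scale:
  assumes "is_potential x \<phi>"
  shows "is_potential (c *\<^sub>R x) (c *\<^sub>R \<phi>)"
proof -
  interpret linear \<gamma> by (rule elliptic_linear[OF \<gamma>])
  show ?thesis
    using assms perp_Vh subspace_scale[OF perp_subspace]
    by (auto simp: is_potential_def scale d_scale)
qed

text \<open>
  Testing with \<open>w = d \<phi>\<close> bounds \<open>d \<phi>\<close> by \<open>\<gamma> x\<close>; the Poincare inequality does the rest.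
\<close>
lemma potential_norm_le:
  assumes "is_potential x \<phi>"
  shows "norm \<phi> \<le> K * M * norm x"
proof -
  have \<phi>: "\<phi> \<in> discrete_kernel_perp \<beta> d Vh" "d \<phi> \<in> Wh"
    using assms perp_Vh d_Wh by (auto simp: is_potential_def)
  have "norm (d \<phi>) * norm (d \<phi>) = inner (\<gamma> x) (d \<phi>)"
    using assms \<phi>(2) by (simp add: is_potential_def power2_norm_eq_inner flip: power2_eq_square)
  also have "\<dots> \<le> M * norm x * norm (d \<phi>)"
    using elliptic_inner_le[OF \<gamma>, of x "d \<phi>"] by simp
  finally have *: "norm (d \<phi>) * norm (d \<phi>) \<le> (M * norm x) * norm (d \<phi>)" .
  have "norm (d \<phi>) \<le> M * norm x"
  proof (cases "d \<phi> = 0")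
    case True
    then show ?thesis using M by simp
  next
    case False
    then show ?thesis using mult_right_le_imp_le[OF *] by simp
  qed
  then have "K * norm (d \<phi>) \<le> K * (M * norm x)" using K by simp
  then show ?thesis using poincare[OF \<phi>(1)] by (simp add: mult.assoc)
qed

text \<open>
  Project \<open>\<gamma> x\<close> orthogonally to \<open>d V\<^sub>h\<close>. The residual is orthogonal to \<open>d V\<^sub>h\<close> by construction and to
  the complement of \<open>d V\<^sub>h\<close> in \<open>W\<^sub>h\<close> by the hypothesis on \<open>x\<close>, hence to all of \<open>W\<^sub>h\<close>.
\<close>
lemma potential_exists:
  assumes x: "\<And>y. y \<in> discrete_range_complement d Vh Wh \<Longrightarrow> inner (\<gamma> x) y = 0"
  obtains \<phi> where "is_potential x \<phi>"
proof -
  obtain g where g: "g \<in> d ` Vh" "\<And>z. z \<in> d ` Vh \<Longrightarrow> inner (\<gamma> x - g) z = 0"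
    using elliptic_projection[OF elliptic_id _ range_fin_dim, where x = "\<gamma> x"] by auto
  then obtain v where v: "v \<in> Vh" "g = d v" by blast
  obtain p where p: "p \<in> discrete_kernel_perp \<beta> d Vh" "d p = d v"
    using kernel_splitting[OF v(1)] by metis
  have "inner (\<gamma> x) w = inner (d p) w" if w: "w \<in> Wh" for w
  proof -
    obtain q where q: "q \<in> d ` Vh" "\<And>z. z \<in> d ` Vh \<Longrightarrow> inner (w - q) z = 0"
      using elliptic_projection[OF elliptic_id _ range_fin_dim, where x = w] by auto
    have "q \<in> Wh" using q(1) d_Wh by auto
    then have y: "w - q \<in> discrete_range_complement d Vh Wh"
      using q(2) w subspace_diff[OF Wh_subspace] by (auto simp: discrete_range_complement_def)
    have "inner (\<gamma> x - g) (w - q) = 0"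
      using x[OF y] q(2)[OF g(1)] by (simp add: inner_diff_left inner_commute[of g])
    then have "inner (\<gamma> x - g) w = 0"
      using g(2)[OF q(1)] by (simp add: inner_diff_right)
    then show ?thesis using p v by (simp add: inner_diff_left)
  qed
  then show ?thesis using that p(1) by (auto simp: is_potential_def)
qed

end

section \<open>Energy decay\<close>

text \<open>
  Gronwall's inequality in the form used here: \<open>exp (c t) * F t\<close> is nonincreasing by the mean value
  theorem. Derivatives are one-sided at 0.
\<close>
lemma exponential_decay_halfline:
  fixes F F' :: "real \<Rightarrow> real"
  assumes deriv: "\<And>t. t \<ge> 0 \<Longrightarrow> (F has_vector_derivative F' t) (at t within {0..})"
    and le: "\<And>t. t \<ge> 0 \<Longrightarrow> F' t \<le> - c * F t" and st: "0 \<le> s" "s \<le> t"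
  shows "F t \<le> exp (- c * (t - s)) * F s"
proof (cases "s = t")
  case False
  then have "s < t" using st by simp
  define G where "G r = exp (c * r) * F r" for r
  have der: "(G has_derivative (*) (exp (c * r) * (c * F r + F' r))) (at r within {s..t})"
    if r: "s \<le> r" "r \<le> t" for r
  proof -
    have "(F has_real_derivative F' r) (at r within {s..t})"
      using has_vector_derivative_within_subset[OF deriv[of r], of "{s..t}"] r st
      by (auto simp: has_real_derivative_iff_has_vector_derivative)
    then have "(G has_real_derivative exp (c * r) * (c * F r + F' r)) (at r within {s..t})"
      unfolding G_def by (auto intro!: derivative_eq_intros simp: algebra_simps)
    then show ?thesis
      by (simp add: has_field_derivative_def)
  qed
  obtain r where r: "r \<in> {s<..<t}" "G t - G s = exp (c * r) * (c * F r + F' r) * (t - s)"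
    using mvt_simple[OF \<open>s < t\<close> der] by auto
  have "c * F r + F' r \<le> 0" using le[of r] r st by simp
  then have "exp (c * r) * (c * F r + F' r) * (t - s) \<le> 0"
    using \<open>s < t\<close> by (simp add: mult_le_0_iff)
  then have "G t \<le> G s" using r(2) by simp
  then have "exp (- c * t) * G t \<le> exp (- c * t) * G s" by simp
  then show ?thesis
    by (simp add: G_def algebra_simps flip: exp_add mult.assoc)
qed simp

lemma has_vector_derivative_linear_inner:
  fixes A :: "'a::real_inner \<Rightarrow> 'a"
  assumes A: "elliptic m M A"
    and f: "(f has_vector_derivative f') (at t within S)"
    and g: "(g has_vector_derivative g') (at t within S)"
  shows "((\<lambda>t. inner (A (f t)) (g t)) has_vector_derivative
    (inner (A f') (g t) + inner (A (f t)) g')) (at t within S)"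
proof -
  have "bounded_linear A"
    using elliptic_linear[OF A] elliptic_norm[OF A]
    by (auto simp: bounded_linear_def bounded_linear_axioms_def mult.commute intro!: exI[of _ M])
  from bounded_linear.has_vector_derivative[OF this f]
  have "((\<lambda>t. A (f t)) has_vector_derivative A f') (at t within S)" .
  from bounded_bilinear.has_vector_derivative[OF bounded_bilinear_inner this g]
  show ?thesis by (simp add: add.commute)
qed

context discrete_system
begin

text \<open>
  The solution itself is the test function; \<open>\<langle>u\<^sup>*, d u\<rangle>\<close> enters the two equations with opposite
  signs.
\<close>
lemma energy_has_derivative:
  assumes sol: "discrete_solution \<alpha> \<beta> \<gamma> d Vh Wh u us" and t: "t \<ge> 0"
  shows "((\<lambda>t. inner (\<alpha> (u t)) (u t) + inner (\<gamma> (us t)) (us t)) has_vector_derivative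
    - 2 * inner (\<beta> (u t)) (u t)) (at t within {0..})"
proof -
  have du: "(u has_vector_derivative time_deriv u t) (at t within {0..})"
    and dus: "(us has_vector_derivative time_deriv us t) (at t within {0..})"
    and e1: "inner (\<alpha> (time_deriv u t)) (u t) - inner (us t) (d (u t)) = - inner (\<beta> (u t)) (u t)"
    and e2: "inner (\<gamma> (time_deriv us t)) (us t) + inner (d (u t)) (us t) = 0"
    using sol t by (auto simp: discrete_solution_def C1_halfline_def vector_derivative_works)
  have "inner (\<alpha> (u t)) (time_deriv u t) = inner (\<alpha> (time_deriv u t)) (u t)"
    "inner (\<gamma> (us t)) (time_deriv us t) = inner (\<gamma> (time_deriv us t)) (us t)"
    by (simp_all add: elliptic_sym[OF \<alpha>] elliptic_sym[OF \<gamma>] inner_commute)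
  then have "(inner (\<alpha> (time_deriv u t)) (u t) + inner (\<alpha> (u t)) (time_deriv u t)) +
      (inner (\<gamma> (time_deriv us t)) (us t) + inner (\<gamma> (us t)) (time_deriv us t)) =
      - 2 * inner (\<beta> (u t)) (u t)"
    using e1 e2 inner_commute[of "us t" "d (u t)"] by simp
  then show ?thesis
    using has_vector_derivative_add[OF has_vector_derivative_linear_inner[OF \<alpha> du du]
        has_vector_derivative_linear_inner[OF \<gamma> dus dus]] by simp
qed

text \<open>
  Testing the second equation with \<open>y\<close> removes the coupling term, so \<open>\<langle>\<gamma> u\<^sup>*, y\<rangle>\<close> is constant.
\<close>
lemma compatibility_conserved:
  assumes sol: "discrete_solution \<alpha> \<beta> \<gamma> d Vh Wh u us"
    and y: "y \<in> discrete_range_complement d Vh Wh"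
    and init: "inner (\<gamma> (us 0)) y = 0" and t: "t \<ge> 0"
  shows "inner (\<gamma> (us t)) y = 0"
proof -
  have "((\<lambda>t. inner (\<gamma> (us t)) y) has_derivative (\<lambda>h. 0)) (at r within {0..})"
    if r: "r \<in> {0..}" for r
  proof -
    have dus: "(us has_vector_derivative time_deriv us r) (at r within {0..})"
      and ur: "u r \<in> Vh"
      and e2: "\<And>w. w \<in> Wh \<Longrightarrow> inner (\<gamma> (time_deriv us r)) w + inner (d (u r)) w = 0"
      using sol r by (auto simp: discrete_solution_def C1_halfline_def vector_derivative_works)
    have "inner (\<gamma> (time_deriv us r)) y = 0"
      using e2[of y] y ur by (simp add: discrete_range_complement_def inner_commute)
    then show ?thesis
      using has_vector_derivative_linear_inner[OF \<gamma> dus has_vector_derivative_const[of y]]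
      by (simp add: has_vector_derivative_def)
  qed
  from has_derivative_zero_constant[OF _ this]
  obtain k where "\<And>r. r \<in> {0..} \<Longrightarrow> inner (\<gamma> (us r)) y = k" by auto
  then show ?thesis using init t by (metis atLeast_iff order_refl)
qed

text \<open>
  The remainder of the first-order expansion of \<open>\<phi>\<close> is a potential of the remainder for \<open>u\<^sup>*\<close>, so
  \<open>potential_norm_le\<close> transfers its smallness.
\<close>
lemma potential_has_derivative:
  assumes "(us has_vector_derivative us') (at t within S)" "t \<in> S"
    and pot: "\<And>r. r \<in> S \<Longrightarrow> is_potential (us r) (\<phi> r)"
    and pot': "is_potential us' \<psi>"
  shows "(\<phi> has_vector_derivative \<psi>) (at t within S)"
  unfolding has_vector_derivative_def has_derivative_within'
proof (intro conjI allI impI)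
  show "bounded_linear (\<lambda>x. x *\<^sub>R \<psi>)" by (rule bounded_linear_scaleR_left)
  fix e :: real assume "0 < e"
  then have "0 < e / (K * M)" using K M by simp
  with assms(1) obtain \<delta> where \<delta>: "\<delta> > 0"
    "\<And>r. r \<in> S \<Longrightarrow> 0 < norm (r - t) \<Longrightarrow> norm (r - t) < \<delta> \<Longrightarrow>
      norm (us r - us t - (r - t) *\<^sub>R us') / norm (r - t) < e / (K * M)"
    unfolding has_vector_derivative_def has_derivative_within' by blast
  have "norm (\<phi> r - \<phi> t - (r - t) *\<^sub>R \<psi>) / norm (r - t) < e"
    if r: "r \<in> S" "0 < norm (r - t)" "norm (r - t) < \<delta>" for r
  proof -
    have "is_potential (us r - us t - (r - t) *\<^sub>R us') (\<phi> r - \<phi> t - (r - t) *\<^sub>R \<psi>)"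
      using pot r(1) assms(2) pot' by (intro is_potential_diff is_potential_scale)
    from potential_norm_le[OF this] show ?thesis
      using \<delta>(2)[OF r] r(2) K M by (simp add: field_simps)
  qed
  then show "\<exists>\<delta>>0. \<forall>r\<in>S. 0 < norm (r - t) \<and> norm (r - t) < \<delta> \<longrightarrow>
      norm (\<phi> r - \<phi> t - (r - t) *\<^sub>R \<psi>) / norm (r - t) < e"
    using \<delta>(1) by blast
qed

text \<open>
  This is where \<open>u\<^sup>*\<close> acquires its damping. The test function \<open>\<phi>\<close> in the first equation turns the
  coupling term into \<open>\<langle>u\<^sup>*, d \<phi>\<rangle> = \<parallel>u\<^sup>*\<parallel>\<^sub>\<gamma>\<^sup>2\<close>. The derivative of \<open>\<phi>\<close> is bounded by \<open>u\<close> and not only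
  by \<open>d u\<close>, for which no uniform bound is available.
\<close>
lemma cross_term_has_derivative:
  assumes sol: "discrete_solution \<alpha> \<beta> \<gamma> d Vh Wh u us"
    and pot: "\<And>r. r \<ge> 0 \<Longrightarrow> is_potential (us r) (\<phi> r)" and t: "t \<ge> 0"
  obtains G' where "((\<lambda>t. inner (\<alpha> (u t)) (\<phi> t)) has_vector_derivative G') (at t within {0..})"
    "m * (norm (us t))\<^sup>2 - K * M\<^sup>2 * (norm (u t) * norm (us t)) - M\<^sup>2 / m * (norm (u t))\<^sup>2 \<le> G'"
proof -
  have mem: "u t \<in> Vh" "us t \<in> Wh"
    and du: "(u has_vector_derivative time_deriv u t) (at t within {0..})"
    and dus: "(us has_vector_derivative time_deriv us t) (at t within {0..})"
    and e1: "\<And>v. v \<in> Vh \<Longrightarrow>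
      inner (\<alpha> (time_deriv u t)) v - inner (us t) (d v) = - inner (\<beta> (u t)) v"
    and e2: "\<And>w. w \<in> Wh \<Longrightarrow> inner (\<gamma> (time_deriv us t)) w + inner (d (u t)) w = 0"
    using sol t by (auto simp: discrete_solution_def C1_halfline_def vector_derivative_works)
  \<comment> \<open>By the second equation \<open>- d u\<close> represents \<open>\<gamma>\<close> applied to the derivative of \<open>u\<^sup>*\<close>, so the potential
     of that derivative is minus the part of \<open>u\<close> in the complement of the kernel.\<close>
  obtain p where p: "p \<in> discrete_kernel_perp \<beta> d Vh" "d p = d (u t)"
    "norm p \<le> M / m * norm (u t)"
    using kernel_splitting[OF mem(1)] by metis
  have \<psi>: "is_potential (time_deriv us t) ((-1) *\<^sub>R p)"
    unfolding is_potential_def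
  proof (intro conjI ballI)
    show "(-1) *\<^sub>R p \<in> discrete_kernel_perp \<beta> d Vh"
      by (rule subspace_scale[OF perp_subspace p(1)])
    fix w assume "w \<in> Wh"
    then show "inner (\<gamma> (time_deriv us t)) w = inner (d ((-1) *\<^sub>R p)) w"
      using e2[of w] d_scale[OF perp_Vh[OF p(1)], of "-1"] p(2) by simp
  qed
  have d\<phi>: "(\<phi> has_vector_derivative ((-1) *\<^sub>R p)) (at t within {0..})"
    by (rule potential_has_derivative[OF dus _ _ \<psi>]) (use t pot in auto)
  have \<phi>: "\<phi> t \<in> Vh" "inner (\<gamma> (us t)) (us t) = inner (d (\<phi> t)) (us t)"
    using pot[OF t] mem perp_Vh by (auto simp: is_potential_def)
  define G' where
    "G' = inner (\<alpha> (time_deriv u t)) (\<phi> t) + inner (\<alpha> (u t)) ((-1) *\<^sub>R p)"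
  have "G' = inner (\<gamma> (us t)) (us t) - inner (\<beta> (u t)) (\<phi> t) - inner (\<alpha> (u t)) p"
    using e1[OF \<phi>(1)] \<phi>(2) by (simp add: G'_def inner_commute)
  moreover have "m * (norm (us t))\<^sup>2 \<le> inner (\<gamma> (us t)) (us t)"
    by (rule elliptic_lower[OF \<gamma>])
  moreover have "inner (\<beta> (u t)) (\<phi> t) \<le> K * M\<^sup>2 * (norm (u t) * norm (us t))"
  proof -
    have "inner (\<beta> (u t)) (\<phi> t) \<le> M * norm (u t) * norm (\<phi> t)"
      using elliptic_inner_le[OF \<beta>, of "u t" "\<phi> t"] by simp
    also have "\<dots> \<le> M * norm (u t) * (K * M * norm (us t))"
      using M by (intro mult_left_mono potential_norm_le pot t) simp
    finally show ?thesis by (simp add: power2_eq_square algebra_simps)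
  qed
  moreover have "inner (\<alpha> (u t)) p \<le> M\<^sup>2 / m * (norm (u t))\<^sup>2"
  proof -
    have "inner (\<alpha> (u t)) p \<le> M * norm (u t) * norm p"
      using elliptic_inner_le[OF \<alpha>, of "u t" p] by simp
    also have "\<dots> \<le> M * norm (u t) * (M / m * norm (u t))"
      using M by (intro mult_left_mono p) simp
    finally show ?thesis by (simp add: power2_eq_square algebra_simps)
  qed
  ultimately show ?thesis
    using that[of G'] has_vector_derivative_linear_inner[OF \<alpha> du d\<phi>] by (simp add: G'_def)
qed

end

text \<open>
  The factor \<open>\<epsilon>\<close> of the cross term in the Lyapunov functional. The first entry of the minimum keeps
  the functional comparable to the energy, the second one makes the damping of \<open>u\<close> dominate the
  terms that the cross term produces.
\<close>
definition decay_weight :: "real \<Rightarrow> real \<Rightarrow> real \<Rightarrow> real" where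
  "decay_weight m M K =
     min (m / (K * M\<^sup>2)) (m / ((K * M\<^sup>2)\<^sup>2 / (2 * m) + M\<^sup>2 / m))"

definition decay_rate :: "real \<Rightarrow> real \<Rightarrow> real \<Rightarrow> real" where
  "decay_rate m M K = 2 * min m (decay_weight m M K * m / 2) / (3 * M)"

lemma decay_weight_pos:
  assumes "m > 0" "M > 0" "K > 0"
  shows "decay_weight m M K > 0"
  using assms by (auto simp: decay_weight_def intro!: divide_pos_pos add_pos_pos)

lemma decay_rate_pos:
  assumes "m > 0" "M > 0" "K > 0"
  shows "decay_rate m M K > 0"
  using assms decay_weight_pos[OF assms] by (simp add: decay_rate_def)

text \<open>
  Here \<open>X\<close> and \<open>Y\<close> stand for \<open>\<parallel>u\<parallel>\<close> and \<open>\<parallel>u\<^sup>*\<parallel>\<close>. Young's inequality splits the mixed term so that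
  half of the new damping \<open>\<epsilon> m Y\<^sup>2\<close> and half of the old damping \<open>2 m X\<^sup>2\<close> survive. The factor
  \<open>3 M / 2\<close> anticipates that the Lyapunov functional is at most \<open>3 M / 2 * (X\<^sup>2 + Y\<^sup>2)\<close>.
\<close>
lemma dissipation_absorbs_cross_term:
  fixes X Y :: real
  assumes pos: "m > 0" "M > 0" "K > 0"
  defines "\<epsilon> \<equiv> decay_weight m M K"
  shows "- 2 * (m * X\<^sup>2) - \<epsilon> * (m * Y\<^sup>2 - K * M\<^sup>2 * (X * Y) - M\<^sup>2 / m * X\<^sup>2)
    \<le> - (3 * M / 2 * decay_rate m M K) * (X\<^sup>2 + Y\<^sup>2)"
proof -
  define L where "L = K * M\<^sup>2"
  define N where "N = M\<^sup>2 / m"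
  define \<delta> where "\<delta> = min m (\<epsilon> * m / 2)"
  have \<delta>: "\<delta> \<le> m" "\<delta> \<le> \<epsilon> * m / 2" by (simp_all add: \<delta>_def)
  have LN: "L > 0" "N > 0" using pos by (auto simp: L_def N_def)
  have \<epsilon>: "\<epsilon> > 0" unfolding \<epsilon>_def by (rule decay_weight_pos[OF pos])
  have "\<epsilon> \<le> m / (L\<^sup>2 / (2 * m) + N)" by (simp add: \<epsilon>_def decay_weight_def L_def N_def)
  moreover have "L\<^sup>2 / (2 * m) + N > 0" using LN pos by (simp add: add_pos_pos)
  ultimately have small: "\<epsilon> * (L\<^sup>2 / (2 * m) + N) \<le> m" by (simp add: pos_le_divide_eq)
  have "0 \<le> (m * Y - L * X)\<^sup>2 / (2 * m)" using pos by simp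
  also have "\<dots> = m / 2 * Y\<^sup>2 + L\<^sup>2 / (2 * m) * X\<^sup>2 - L * (X * Y)"
    using pos by (simp add: power2_eq_square field_simps)
  finally have young: "L * (X * Y) \<le> m / 2 * Y\<^sup>2 + L\<^sup>2 / (2 * m) * X\<^sup>2" by simp
  have "\<epsilon> * (L * (X * Y)) \<le> \<epsilon> * (m / 2 * Y\<^sup>2 + L\<^sup>2 / (2 * m) * X\<^sup>2)"
    using young \<epsilon> by (intro mult_left_mono) simp_all
  moreover have "\<epsilon> * (L\<^sup>2 / (2 * m) + N) * X\<^sup>2 \<le> m * X\<^sup>2"
    using small by (rule mult_right_mono) simp
  ultimately have "- 2 * (m * X\<^sup>2) - \<epsilon> * (m * Y\<^sup>2 - L * (X * Y) - N * X\<^sup>2)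
      \<le> - m * X\<^sup>2 - (\<epsilon> * m / 2) * Y\<^sup>2"
    by (simp add: algebra_simps)
  also have "\<dots> \<le> - \<delta> * X\<^sup>2 - \<delta> * Y\<^sup>2"
    using mult_right_mono[of \<delta> m "X\<^sup>2"] mult_right_mono[of \<delta> "\<epsilon> * m / 2" "Y\<^sup>2"] \<delta>
    by simp
  also have "\<dots> = - (3 * M / 2 * decay_rate m M K) * (X\<^sup>2 + Y\<^sup>2)"
    using pos by (simp add: decay_rate_def \<delta>_def \<epsilon>_def algebra_simps)
  finally show ?thesis by (simp add: L_def N_def)
qed

context discrete_system
begin

lemma energy_decay:
  assumes sol: "discrete_solution \<alpha> \<beta> \<gamma> d Vh Wh u us"
    and compat: "\<And>y. y \<in> discrete_range_complement d Vh Wh \<Longrightarrow> inner (\<gamma> (us 0)) y = 0"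
    and st: "0 \<le> s" "s \<le> t"
  defines "E \<equiv> \<lambda>t. inner (\<alpha> (u t)) (u t) + inner (\<gamma> (us t)) (us t)"
  shows "E t \<le> 3 * exp (- decay_rate m M K * (t - s)) * E s"
proof -
  define \<epsilon> where "\<epsilon> = decay_weight m M K"
  define c where "c = decay_rate m M K"
  have \<epsilon>: "\<epsilon> > 0" unfolding \<epsilon>_def by (rule decay_weight_pos[OF m M K])
  have c: "c > 0" unfolding c_def by (rule decay_rate_pos[OF m M K])
  have "\<epsilon> \<le> m / (K * M\<^sup>2)" by (simp add: \<epsilon>_def decay_weight_def)
  then have small: "\<epsilon> * (K * M\<^sup>2) \<le> m" using K M by (simp add: pos_le_divide_eq)
  have "\<exists>\<phi>. is_potential (us r) \<phi>" if "r \<ge> 0" for r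
    using potential_exists compatibility_conserved[OF sol _ compat that] by metis
  then obtain \<phi> where \<phi>: "\<And>r. r \<ge> 0 \<Longrightarrow> is_potential (us r) (\<phi> r)" by metis
  define F where "F r = E r - \<epsilon> * inner (\<alpha> (u r)) (\<phi> r)" for r
  have E_low: "m * ((norm (u r))\<^sup>2 + (norm (us r))\<^sup>2) \<le> E r" for r
    using elliptic_lower[OF \<alpha>, of "u r"] elliptic_lower[OF \<gamma>, of "us r"]
    by (simp add: E_def distrib_left)
  have E_up: "E r \<le> M * ((norm (u r))\<^sup>2 + (norm (us r))\<^sup>2)" for r
    using elliptic_upper[OF \<alpha>, of "u r"] elliptic_upper[OF \<gamma>, of "us r"]
    by (simp add: E_def distrib_left)
  have cross: "\<bar>\<epsilon> * inner (\<alpha> (u r)) (\<phi> r)\<bar> \<le> E r / 2" if r: "r \<ge> 0" for r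
  proof -
    have "\<bar>inner (\<alpha> (u r)) (\<phi> r)\<bar> \<le> M * norm (u r) * norm (\<phi> r)"
      by (rule elliptic_inner_le[OF \<alpha>])
    also have "\<dots> \<le> M * norm (u r) * (K * M * norm (us r))"
      using M by (intro mult_left_mono potential_norm_le \<phi> r) simp
    finally have "\<epsilon> * \<bar>inner (\<alpha> (u r)) (\<phi> r)\<bar> \<le> \<epsilon> * (M * norm (u r) * (K * M * norm (us r)))"
      using \<epsilon> by simp
    also have "\<dots> = (\<epsilon> * (K * M\<^sup>2)) * (norm (u r) * norm (us r))"
      by (simp add: power2_eq_square algebra_simps)
    also have "\<dots> \<le> m * (norm (u r) * norm (us r))"
      using small by (rule mult_right_mono) simp
    also have "\<dots> \<le> m * (((norm (u r))\<^sup>2 + (norm (us r))\<^sup>2) / 2)"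
      using m sum_squares_bound[of "norm (u r)" "norm (us r)"] by (intro mult_left_mono) simp_all
    also have "\<dots> \<le> E r / 2" using E_low[of r] by simp
    finally show ?thesis using \<epsilon> by (simp add: abs_mult)
  qed
  have "\<exists>F'. (F has_vector_derivative F') (at r within {0..}) \<and> F' \<le> - c * F r"
    if r: "r \<ge> 0" for r
  proof -
    let ?X = "norm (u r)" and ?Y = "norm (us r)"
    obtain G' where G': "((\<lambda>t. inner (\<alpha> (u t)) (\<phi> t)) has_vector_derivative G') (at r within {0..})"
      "m * ?Y\<^sup>2 - K * M\<^sup>2 * (?X * ?Y) - M\<^sup>2 / m * ?X\<^sup>2 \<le> G'"
      using cross_term_has_derivative[OF sol \<phi> r] by blast
    have "(F has_vector_derivative (- 2 * inner (\<beta> (u r)) (u r) - \<epsilon> * G')) (at r within {0..})"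
      using has_vector_derivative_diff[OF energy_has_derivative[OF sol r]
          has_vector_derivative_mult_right[OF G'(1)]]
      by (simp add: F_def[abs_def] E_def)
    moreover have "- 2 * inner (\<beta> (u r)) (u r) - \<epsilon> * G' \<le> - c * F r"
    proof -
      have "- 2 * inner (\<beta> (u r)) (u r) - \<epsilon> * G'
          \<le> - 2 * (m * ?X\<^sup>2) - \<epsilon> * (m * ?Y\<^sup>2 - K * M\<^sup>2 * (?X * ?Y) - M\<^sup>2 / m * ?X\<^sup>2)"
        using elliptic_lower[OF \<beta>, of "u r"] mult_left_mono[OF G'(2), of \<epsilon>] \<epsilon> by linarith
      also have "\<dots> \<le> - (3 * M / 2 * c) * (?X\<^sup>2 + ?Y\<^sup>2)"
        unfolding \<epsilon>_def c_def by (rule dissipation_absorbs_cross_term[OF m M K])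
      also have "\<dots> \<le> - c * F r"
      proof -
        have "F r \<le> 3 / 2 * E r" using cross[OF r] by (simp add: F_def abs_le_iff)
        also have "\<dots> \<le> 3 / 2 * (M * (?X\<^sup>2 + ?Y\<^sup>2))" using E_up[of r] by simp
        finally have "c * F r \<le> c * (3 / 2 * (M * (?X\<^sup>2 + ?Y\<^sup>2)))" using c by simp
        then show ?thesis by (simp add: algebra_simps)
      qed
      finally show ?thesis .
    qed
    ultimately show ?thesis by blast
  qed
  then obtain F' where "\<And>r. r \<ge> 0 \<Longrightarrow> (F has_vector_derivative F' r) (at r within {0..})"
    "\<And>r. r \<ge> 0 \<Longrightarrow> F' r \<le> - c * F r" by metis
  from exponential_decay_halfline[OF this st]
  have decay: "F t \<le> exp (- c * (t - s)) * F s" .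
  have "E t \<le> 2 * F t" using cross[of t] st by (simp add: F_def abs_le_iff)
  also have "\<dots> \<le> 2 * (exp (- c * (t - s)) * F s)" using decay by simp
  also have "\<dots> \<le> 2 * (exp (- c * (t - s)) * (3 / 2 * E s))"
    using cross[OF st(1)] by (simp add: F_def abs_le_iff)
  finally show ?thesis by (simp add: c_def algebra_simps)
qed

end

text \<open>
  The bound \<open>N\<close> of the inverse weight and the lower bound \<open>m\<close> of \<open>\<alpha>\<close> translate the weighted Poincare
  inequality into the unweighted norms.
\<close>
lemma discrete_poincare_norm:
  assumes \<alpha>: "elliptic m M \<alpha>" "m > 0" and "CP > 0"
    and N: "N > 0" "\<And>x. norm (inv \<gamma> x) \<le> norm x * N"
    and P: "discrete_poincare \<alpha> \<beta> \<gamma> d Vh CP" and v: "v \<in> discrete_kernel_perp \<beta> d Vh"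
  shows "norm v \<le> CP * sqrt (N / m) * norm (d v)"
proof -
  have "sqrt m * norm v = sqrt (m * (norm v)\<^sup>2)" by (simp add: real_sqrt_mult)
  also have "\<dots> \<le> weighted_norm \<alpha> v"
    unfolding weighted_norm_def by (intro real_sqrt_le_mono elliptic_lower[OF \<alpha>(1)])
  also have "\<dots> \<le> CP * weighted_norm (inv \<gamma>) (d v)"
    using P v by (auto simp: discrete_poincare_def)
  also have "\<dots> \<le> CP * sqrt (N * (norm (d v))\<^sup>2)"
  proof -
    have "inner (inv \<gamma> (d v)) (d v) \<le> norm (inv \<gamma> (d v)) * norm (d v)"
      by (rule norm_cauchy_schwarz)
    also have "\<dots> \<le> (norm (d v) * N) * norm (d v)"
      by (intro mult_right_mono N) simp
    finally show ?thesis
      using \<open>CP > 0\<close> by (simp add: weighted_norm_def power2_eq_square algebra_simps)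
  qed
  finally have "sqrt m * norm v \<le> CP * (sqrt N * norm (d v))" by (simp add: real_sqrt_mult)
  then show ?thesis using \<alpha>(2) by (simp add: real_sqrt_divide field_simps)
qed

theorem theorem4p3:
  fixes V1 :: "'a::{real_inner,complete_space} set"
    and d :: "'a \<Rightarrow> 'b::{real_inner,complete_space}"
    and \<alpha> \<beta> :: "'a \<Rightarrow> 'a"
    and \<gamma> :: "'b \<Rightarrow> 'b"
    and CP :: real
  assumes "densely_defined_closed_operator V1 d"
    and "selfadjoint_positive_iso \<alpha>"
    and "selfadjoint_positive_iso \<beta>"
    and "selfadjoint_positive_iso \<gamma>"
    and "CP > 0"
  shows "\<exists>C > 0. \<exists>c > 0.
    \<forall>Vh Wh. fin_dim_subspace Vh \<and> fin_dim_subspace Wh \<and> Vh \<subseteq> V1 \<and> d ` Vh \<subseteq> Wh \<and>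
        discrete_poincare \<alpha> \<beta> \<gamma> d Vh CP \<longrightarrow>
      (\<forall>u us. discrete_solution \<alpha> \<beta> \<gamma> d Vh Wh u us \<and>
          (\<forall>y\<in>discrete_range_complement d Vh Wh. inner (\<gamma> (us 0)) y = 0) \<longrightarrow>
        (\<forall>s t. 0 \<le> s \<and> s \<le> t \<longrightarrow>
          (weighted_norm \<alpha> (u t))\<^sup>2 + (weighted_norm \<gamma> (us t))\<^sup>2
            \<le> C * exp (- c * (t - s)) *
                ((weighted_norm \<alpha> (u s))\<^sup>2 + (weighted_norm \<gamma> (us s))\<^sup>2)))"
proof -
  obtain m1 M1 where 1: "m1 > 0" "M1 > 0" "elliptic m1 M1 \<alpha>"
    using selfadjoint_positive_iso_elliptic[OF assms(2)] by blast
  obtain m2 M2 where 2: "m2 > 0" "M2 > 0" "elliptic m2 M2 \<beta>"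
    using selfadjoint_positive_iso_elliptic[OF assms(3)] by blast
  obtain m3 M3 where 3: "m3 > 0" "M3 > 0" "elliptic m3 M3 \<gamma>"
    using selfadjoint_positive_iso_elliptic[OF assms(4)] by blast
  have "bounded_linear (inv \<gamma>)" using assms(4) by (simp add: selfadjoint_positive_iso_def)
  then obtain N where N: "N > 0" "\<And>x. norm (inv \<gamma> x) \<le> norm x * N"
    using bounded_linear.pos_bounded by blast
  define m where "m = min m1 (min m2 m3)"
  define M where "M = max M1 (max M2 M3)"
  define K where "K = CP * sqrt (N / m)"
  have m: "m > 0" and M: "M > 0" using 1 2 3 by (auto simp: m_def M_def)
  have K: "K > 0" using assms(5) N(1) m by (simp add: K_def)
  have \<alpha>: "elliptic m M \<alpha>" by (rule elliptic_mono[OF 1(3)]) (auto simp: m_def M_def)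
  have \<beta>: "elliptic m M \<beta>" by (rule elliptic_mono[OF 2(3)]) (auto simp: m_def M_def)
  have \<gamma>: "elliptic m M \<gamma>" by (rule elliptic_mono[OF 3(3)]) (auto simp: m_def M_def)
  show ?thesis
  proof (rule exI[of _ "3::real"], rule conjI[OF zero_less_numeral],
      rule exI[of _ "decay_rate m M K"], intro conjI allI impI)
    show "0 < decay_rate m M K" by (rule decay_rate_pos[OF m M K])
    fix Vh Wh u us and s t :: real
    assume spaces: "fin_dim_subspace Vh \<and> fin_dim_subspace Wh \<and> Vh \<subseteq> V1 \<and> d ` Vh \<subseteq> Wh \<and>
        discrete_poincare \<alpha> \<beta> \<gamma> d Vh CP"
      and sol: "discrete_solution \<alpha> \<beta> \<gamma> d Vh Wh u us \<and>
          (\<forall>y\<in>discrete_range_complement d Vh Wh. inner (\<gamma> (us 0)) y = 0)"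
      and st: "0 \<le> s \<and> s \<le> t"
    interpret discrete_system Vh Wh d \<alpha> \<beta> \<gamma> m M K
    proof
      show "d (x + y) = d x + d y" if "x \<in> Vh" "y \<in> Vh" for x y
        using that spaces assms(1) unfolding densely_defined_closed_operator_def by blast
      show "d (c *\<^sub>R x) = c *\<^sub>R d x" if "x \<in> Vh" for c x
        using that spaces assms(1) unfolding densely_defined_closed_operator_def by blast
      show "norm v \<le> K * norm (d v)" if "v \<in> discrete_kernel_perp \<beta> d Vh" for v
        unfolding K_def using discrete_poincare_norm[OF \<alpha> m assms(5) N] spaces that by blast
    qed (use spaces m M K \<alpha> \<beta> \<gamma> in auto)
    show "(weighted_norm \<alpha> (u t))\<^sup>2 + (weighted_norm \<gamma> (us t))\<^sup>2
        \<le> 3 * exp (- decay_rate m M K * (t - s)) *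
            ((weighted_norm \<alpha> (u s))\<^sup>2 + (weighted_norm \<gamma> (us s))\<^sup>2)"
      using energy_decay[of u us s t] sol st
      by (simp add: weighted_norm_square[OF \<alpha> m] weighted_norm_square[OF \<gamma> m])
  qed
qed

end
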